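(* For all complex parameters $a,b,b',c$ one has the inclusion of local solution spaces $$(1-y)^{-b'}\,S_2\left(a,b,b',c,a;\,x,\,-\frac{y}{1-y}\right)\ \supset\ S_1\big(b,\,a-b',\,b',\,c;\ x,\ x(1-y)\big),$$ near any point $(x,y)\in\mathbb C^2$ with $x\neq 0,1$, $y\ne 0,1$, $x(1-y)\neq 1$. That is, for every solution $v$ of the system $E_1(b,a-b',b',c)$ near $(x,x(1-y))$, there is a solution $u$ of the system $E_2(a,b,b',c,a)$ near $(x,-y/(1-y))$ such that $v(x,x(1-y))=(1-y)^{-b'}u(x,-y/(1-y))$.
   Context: Write $D=x\,\partial/\partial x$, $D'=y\,\partial/\partial y$. $E_1(a,b,b',c;x,y)$ is Appell's system $P_1z=Q_1z=R_1z=0$, where $P_1=x(1-x)\partial_{xx}+y(1-x)\partial_{xy}+(c-(a+b+1)x)\partial_x-by\,\partial_y-ab$, $Q_1=y(1-y)\partial_{yy}+x(1-y)\partial_{xy}+(c-(a+b'+1)y)\partial_y-b'x\,\partial_x-ab'$, $R_1=(x-y)\partial_{xy}-b'\partial_x+b\,\partial_y$. (The first two equations are $[D(c-1+D+D')-x(a+D+D')(b+D)]z=0$ and $[D'(c-1+D+D')-y(a+D+D')(b'+D')]z=0$.) $S_1(a,b,b',c;x,y)$ is the space of its local holomorphic solutions at points off $xy(1-x)(1-y)(x-y)=0$. $E_2(a,b,b',c,c';x,y)$ is Appell's system $P_2z=Q_2z=0$, where $P_2=D(c-1+D)-x(a+D+D')(b+D)$, $Q_2=D'(c'-1+D')-y(a+D+D')(b'+D')$.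 $S_2(a,b,b',c,c';x,y)$ is the space of its local holomorphic solutions at points off $xy(1-x)(1-y)(1-x-y)=0$. When the variables in $S_1(\dots;\cdot,\cdot)$ or $S_2(\dots;\cdot,\cdot)$ are replaced by functions of $(x,y)$, this means the space of solutions composed with the corresponding map. A fixed local branch of the power function $(1-y)^{-b'}$ is used. *)

theory Defs
  imports "HOL-Complex_Analysis.Complex_Analysis"
begin

text \<open>
  Functions of two complex variables are total functions on \<open>complex \<times> complex\<close>; being a local
  solution at a point only constrains them near that point.  Holomorphy is complex
  Frechet differentiability at every point of an open set.
\<close>

definition holomorphic2_on :: "(complex \<times> complex \<Rightarrow> complex) \<Rightarrow> (complex \<times> complex) set \<Rightarrow> bool"
    (infix \<open>holomorphic2'_on\<close> 50) where
  "f holomorphic2_on U \<longleftrightarrow>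
     open U \<and> (\<forall>q\<in>U. \<exists>\<alpha> \<beta>. (f has_derivative (\<lambda>(h, k). \<alpha> * h + \<beta> * k)) (at q))"

definition pdx :: "(complex \<times> complex \<Rightarrow> complex) \<Rightarrow> complex \<times> complex \<Rightarrow> complex" where
  "pdx f = (\<lambda>(x, y). deriv (\<lambda>s. f (s, y)) x)"

definition pdy :: "(complex \<times> complex \<Rightarrow> complex) \<Rightarrow> complex \<times> complex \<Rightarrow> complex" where
  "pdy f = (\<lambda>(x, y). deriv (\<lambda>t. f (x, t)) y)"

definition P1 :: "complex \<Rightarrow> complex \<Rightarrow> complex \<Rightarrow> complex \<Rightarrow>
    (complex \<times> complex \<Rightarrow> complex) \<Rightarrow> complex \<times> complex \<Rightarrow> complex" where
  "P1 a b b' c z = (\<lambda>(x, y).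
     x * (1 - x) * pdx (pdx z) (x, y) + y * (1 - x) * pdx (pdy z) (x, y)
     + (c - (a + b + 1) * x) * pdx z (x, y) - b * y * pdy z (x, y) - a * b * z (x, y))"

definition Q1 :: "complex \<Rightarrow> complex \<Rightarrow> complex \<Rightarrow> complex \<Rightarrow>
    (complex \<times> complex \<Rightarrow> complex) \<Rightarrow> complex \<times> complex \<Rightarrow> complex" where
  "Q1 a b b' c z = (\<lambda>(x, y).
     y * (1 - y) * pdy (pdy z) (x, y) + x * (1 - y) * pdx (pdy z) (x, y)
     + (c - (a + b' + 1) * y) * pdy z (x, y) - b' * x * pdx z (x, y) - a * b' * z (x, y))"

definition R1 :: "complex \<Rightarrow> complex \<Rightarrow>
    (complex \<times> complex \<Rightarrow> complex) \<Rightarrow> complex \<times> complex \<Rightarrow> complex" where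
  "R1 b b' z = (\<lambda>(x, y).
     (x - y) * pdx (pdy z) (x, y) - b' * pdx z (x, y) + b * pdy z (x, y))"

definition S1 :: "complex \<Rightarrow> complex \<Rightarrow> complex \<Rightarrow> complex \<Rightarrow>
    complex \<times> complex \<Rightarrow> (complex \<times> complex \<Rightarrow> complex) set" where
  "S1 a b b' c p = {z. \<exists>U. p \<in> U \<and> z holomorphic2_on U \<and>
     (\<forall>q\<in>U. P1 a b b' c z q = 0 \<and> Q1 a b b' c z q = 0 \<and> R1 b b' z q = 0)}"

definition Dx :: "(complex \<times> complex \<Rightarrow> complex) \<Rightarrow> complex \<times> complex \<Rightarrow> complex" where
  "Dx f = (\<lambda>(x, y). x * pdx f (x, y))"

definition Dy :: "(complex \<times> complex \<Rightarrow> complex) \<Rightarrow> complex \<times> complex \<Rightarrow> complex" where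
  "Dy f = (\<lambda>(x, y). y * pdy f (x, y))"

text \<open>The inner operators \<open>b + D\<close> and \<open>b' + D'\<close> act first, giving \<open>w\<close>; the coefficient \<open>x\<close>
  (resp. \<open>y\<close>) multiplies from the left and is not differentiated.\<close>

definition P2 :: "complex \<Rightarrow> complex \<Rightarrow> complex \<Rightarrow>
    (complex \<times> complex \<Rightarrow> complex) \<Rightarrow> complex \<times> complex \<Rightarrow> complex" where
  "P2 a b c z = (\<lambda>(x, y).
     (let w = (\<lambda>q. b * z q + Dx z q)
      in Dx (\<lambda>q. (c - 1) * z q + Dx z q) (x, y)
         - x * (a * w (x, y) + Dx w (x, y) + Dy w (x, y))))"

definition Q2 :: "complex \<Rightarrow> complex \<Rightarrow> complex \<Rightarrow>
    (complex \<times> complex \<Rightarrow> complex) \<Rightarrow> complex \<times> complex \<Rightarrow> complex" where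
  "Q2 a b' c' z = (\<lambda>(x, y).
     (let w = (\<lambda>q. b' * z q + Dy z q)
      in Dy (\<lambda>q. (c' - 1) * z q + Dy z q) (x, y)
         - y * (a * w (x, y) + Dx w (x, y) + Dy w (x, y))))"

definition S2 :: "complex \<Rightarrow> complex \<Rightarrow> complex \<Rightarrow> complex \<Rightarrow> complex \<Rightarrow>
    complex \<times> complex \<Rightarrow> (complex \<times> complex \<Rightarrow> complex) set" where
  "S2 a b b' c c' p = {z. \<exists>U. p \<in> U \<and> z holomorphic2_on U \<and>
     (\<forall>q\<in>U. P2 a b c z q = 0 \<and> Q2 a b' c' z q = 0)}"

definition germ :: "'a::topological_space \<Rightarrow> ('a \<Rightarrow> 'b) \<Rightarrow> ('a \<Rightarrow> 'b) set" where
  "germ p f = {g. eventually (\<lambda>q. g q = f q) (nhds p)}"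

text \<open>
  \<open>pw\<close> is, near \<open>y\<^sub>0\<close>, a branch of \<open>\<phi>(y)\<^sup>s\<close>, i.e. \<open>exp (s * l)\<close> for a holomorphic
  branch \<open>l\<close> of the logarithm of \<open>\<phi>\<close>.
\<close>

definition power_branch ::
    "(complex \<Rightarrow> complex) \<Rightarrow> complex \<Rightarrow> complex \<Rightarrow> (complex \<Rightarrow> complex) \<Rightarrow> bool" where
  "power_branch \<phi> s y\<^sub>0 pw \<longleftrightarrow>
     (\<exists>N l. open N \<and> y\<^sub>0 \<in> N \<and> l holomorphic_on N \<and>
        (\<forall>y\<in>N. exp (l y) = \<phi> y \<and> pw y = exp (s * l y)))"

end

theory Submission
  imports Defs
begin

text \<open>
  The substitution \<open>Y = - y / (1 - y)\<close> is an involution with \<open>1 - Y = 1 / (1 - y)\<close>, so the required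
  identity \<open>v (x, x * (1 - y)) = (1 - y) powr (- b') * u (x, Y)\<close> forces
  \<open>u (x, y) = (1 - y) powr (- b') * v (x, x / (1 - y))\<close>, for the branch of the power induced by the
  given one.  It remains to see that this \<open>u\<close> solves \<open>E\<^sub>2\<close>.

  On functions of the form \<open>(1 - y) powr (- b') * g (x, t)\<close>, where \<open>t = x / (1 - y)\<close>, the Euler
  operators act by operators on \<open>g\<close>: writing \<open>\<theta> = x \<partial>/\<partial>x\<close> and \<open>\<phi> = t \<partial>/\<partial>t\<close>, \<open>D\<close> becomes \<open>\<theta> + \<phi>\<close> and
  \<open>D'\<close> becomes \<open>(t / x - 1) (b' + \<phi>)\<close>, the factor being \<open>t / x - 1 = y / (1 - y)\<close>
  (\<open>D_pullback\<close>).  All operators of \<open>E\<^sub>2\<close> can therefore be moved to the side of \<open>v\<close>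
  (\<open>P2_pullback\<close>, \<open>Q2_pullback\<close>), where they are combinations of those of
  \<open>E\<^sub>1\<close> with parameters \<open>b, a - b', b', c\<close>: \<open>P\<^sub>2\<close> turns into \<open>x P\<^sub>1 + t Q\<^sub>1\<close> (\<open>lifted_P2_eq\<close>) and
  \<open>Q\<^sub>2\<close> into \<open>(t - x) R\<^sub>1\<close> (\<open>lifted_Q2_eq\<close>).

  These computations differentiate \<open>v\<close> twice along \<open>(x, x / (1 - y))\<close>.  They need the partial
  derivatives of a holomorphic function of two variables to be holomorphic again, and the mixed
  ones to agree (\<open>holomorphic2_on_pdx\<close>, \<open>holomorphic2_on_pdy\<close>, \<open>pdx_pdy_commute\<close>); both come
  from the one-variable fact that derivatives of locally uniformly convergent
  holomorphic functions converge.
\<close>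

section \<open>Holomorphic functions of two variables\<close>

text \<open>Swapping the variables reduces each statement on one partial derivative to the other.\<close>

lemma pdx_swap: "pdx (f \<circ> prod.swap) = pdy f \<circ> prod.swap"
  by (auto simp: pdx_def pdy_def)

lemma pdy_swap: "pdy (f \<circ> prod.swap) = pdx f \<circ> prod.swap"
  by (auto simp: pdx_def pdy_def)

lemma open_vimage_swap:
  fixes U :: "('a::topological_space \<times> 'b::topological_space) set"
  assumes "open U" shows "open (prod.swap -` U)"
  using assms by (intro open_vimage continuous_intros)

lemma open_contains_cball_Times:
  fixes U :: "(complex \<times> complex) set"
  assumes "open U" "(x, y) \<in> U"
  obtains r where "r > 0" "cball x r \<times> cball y r \<subseteq> U"
proof -
  obtain A B where AB: "open A" "open B" "x \<in> A" "y \<in> B" "A \<times> B \<subseteq> U"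
    using open_prod_elim[OF assms] by (metis mem_Sigma_iff)
  obtain r where "r > 0" "cball x r \<subseteq> A" using AB open_contains_cball by blast
  moreover obtain s where "s > 0" "cball y s \<subseteq> B" using AB open_contains_cball by blast
  ultimately have "cball x (min r s) \<times> cball y (min r s) \<subseteq> U" "min r s > 0"
    using AB by (auto simp: subset_iff)
  then show thesis using that by blast
qed

text \<open>
  Near the point \<open>(x, y)\<close>, the function \<open>f (\<cdot>, y')\<close> translated by \<open>x' - x\<close> is uniformly close to
  \<open>f (\<cdot>, y)\<close> on a disc around \<open>x\<close>, and its derivative at \<open>x\<close> is \<open>pdx f (x', y')\<close>; derivatives of
  uniformly convergent holomorphic functions converge.  The translation serves to evaluate all
  derivatives at the same point.
\<close>

lemma isCont_pdx:
  assumes U: "open U" "(x, y) \<in> U" and cont: "continuous_on U f"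
    and hol: "\<And>x y. (x, y) \<in> U \<Longrightarrow> (\<lambda>s. f (s, y)) field_differentiable (at x)"
  shows "isCont (pdx f) (x, y)"
proof -
  obtain r where r: "r > 0" "cball x r \<times> cball y r \<subseteq> U"
    using open_contains_cball_Times[OF U] .
  define g where "g = (\<lambda>(q :: complex \<times> complex) s. f (s + (fst q - x), snd q))"
  have near: "eventually (\<lambda>q. dist q (x, y) < d) (at (x, y))" if "d > 0" for d
    using that eventually_at by blast
  have shift: "(s + (fst q - x), snd q) \<in> cball x r \<times> cball y r"
    if "dist q (x, y) < r / 2" "s \<in> ball x (r / 2)" for q s
  proof -
    have "norm (fst q - x) < r / 2" "dist (snd q) y < r / 2"
      using that dist_fst_le[of q "(x, y)"] dist_snd_le[of q "(x, y)"] by (auto simp: dist_norm)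
    moreover have "norm (s - x + (fst q - x)) \<le> norm (s - x) + norm (fst q - x)"
      by (rule norm_triangle_ineq)
    moreover have "norm (s - x) < r / 2" using that by (simp add: dist_norm norm_minus_commute)
    moreover have "dist (s + (fst q - x)) x = norm (s - x + (fst q - x))"
      by (simp add: dist_norm algebra_simps)
    ultimately have "dist (s + (fst q - x)) x \<le> r" "dist (snd q) y \<le> r"
      using r(1) by linarith+
    then show ?thesis by (simp add: dist_commute)
  qed
  have "uniform_limit (ball x (r / 2)) g (\<lambda>s. f (s, y)) (at (x, y))"
  proof (rule uniform_limitI)
    fix e :: real assume "e > 0"
    have "uniformly_continuous_on (cball x r \<times> cball y r) f"
      by (intro compact_uniformly_continuous continuous_on_subset[OF cont r(2)] compact_Times
            compact_cball)
    then obtain d where d: "d > 0" "\<And>p q. p \<in> cball x r \<times> cball y r \<Longrightarrow> q \<in> cball x r \<times> cball y r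
        \<Longrightarrow> dist q p < d \<Longrightarrow> dist (f q) (f p) < e"
      using \<open>e > 0\<close> unfolding uniformly_continuous_on_def by metis
    have "eventually (\<lambda>q. dist q (x, y) < min d (r / 2)) (at (x, y))"
      using d r by (intro near) auto
    then show "\<forall>\<^sub>F q in at (x, y). \<forall>s\<in>ball x (r / 2). dist (g q s) (f (s, y)) < e"
    proof eventually_elim
      case (elim q)
      show ?case unfolding g_def
      proof (intro ballI d)
        fix s assume s: "s \<in> ball x (r / 2)"
        show "(s + (fst q - x), snd q) \<in> cball x r \<times> cball y r"
          using elim s by (intro shift) auto
        show "(s, y) \<in> cball x r \<times> cball y r" using s r(1) by auto
        have "dist (s + (fst q - x), snd q) (s, y) = dist q (x, y)"
          by (simp add: dist_prod_def dist_norm)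
        then show "dist (s + (fst q - x), snd q) (s, y) < d" using elim by simp
      qed
    qed
  qed
  moreover have "\<forall>\<^sub>F q in at (x, y). g q holomorphic_on ball x (r / 2)"
    using near[OF half_gt_zero[OF r(1)]]
  proof (rule eventually_mono)
    fix q assume q: "dist q (x, y) < r / 2"
    show "g q holomorphic_on ball x (r / 2)"
      unfolding holomorphic_on_def
    proof (rule ballI, rule field_differentiable_at_within)
      fix s assume s: "s \<in> ball x (r / 2)"
      have "(s + (fst q - x), snd q) \<in> U" using shift[OF q s] r(2) by (rule rev_subsetD)
      from hol[OF this] obtain D
        where "((\<lambda>s. f (s, snd q)) has_field_derivative D) (at (s + (fst q - x)))"
        unfolding field_differentiable_def by (rule exE)
      then have "(g q has_field_derivative D) (at s)"
        unfolding g_def by (rule DERIV_shift[THEN iffD1])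
      then show "g q field_differentiable at s" unfolding field_differentiable_def by (rule exI)
    qed
  qed
  ultimately have "((\<lambda>q. deriv (g q) x) \<longlongrightarrow> deriv (\<lambda>s. f (s, y)) x) (at (x, y))"
    using r(1) by (intro deriv_complex_uniform_limit[where A = "ball x (r / 2)"]) auto
  moreover have "deriv (g q) x = pdx f q" for q
  proof -
    have "deriv (g q) x = deriv (g q \<circ> (+) x) 0" by (rule deriv_shift_0)
    also have "g q \<circ> (+) x = (\<lambda>s. f (s, snd q)) \<circ> (+) (fst q)"
      by (simp add: g_def fun_eq_iff add.commute)
    also have "deriv \<dots> 0 = deriv (\<lambda>s. f (s, snd q)) (fst q)" by (rule deriv_shift_0[symmetric])
    finally show ?thesis by (simp add: pdx_def split_beta)
  qed
  ultimately show ?thesis by (simp add: isCont_def pdx_def)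
qed

lemma isCont_pdy:
  assumes U: "open U" "(x, y) \<in> U" and cont: "continuous_on U f"
    and hol: "\<And>x y. (x, y) \<in> U \<Longrightarrow> (\<lambda>t. f (x, t)) field_differentiable (at y)"
  shows "isCont (pdy f) (x, y)"
proof -
  have "isCont (pdx (f \<circ> prod.swap)) (y, x)"
  proof (rule isCont_pdx)
    show "open (prod.swap -` U)" by (rule open_vimage_swap[OF U(1)])
    show "continuous_on (prod.swap -` U) (f \<circ> prod.swap)"
      by (rule continuous_on_compose) (auto intro!: continuous_intros continuous_on_subset[OF cont])
  qed (use U hol in auto)
  then have "isCont (pdx (f \<circ> prod.swap) \<circ> prod.swap) (x, y)"
    by (intro continuous_at_compose) (auto intro!: continuous_intros)
  then show ?thesis by (simp add: pdx_swap o_assoc[symmetric])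
qed

lemma has_derivative_pair_imp_pdx:
  assumes "(f has_derivative (\<lambda>(h, k). \<alpha> * h + \<beta> * k)) (at (x, y))"
  shows "((\<lambda>s. f (s, y)) has_field_derivative \<alpha>) (at x)"
proof -
  have "((\<lambda>s. f (s, y)) has_derivative (\<lambda>h. (\<lambda>(h, k). \<alpha> * h + \<beta> * k) (h, 0))) (at x)"
    by (rule has_derivative_compose[of "\<lambda>s. (s, y)" "\<lambda>h. (h, 0)", OF _ assms])
       (auto intro!: derivative_eq_intros)
  then show ?thesis by (simp add: has_field_derivative_def)
qed

lemma has_derivative_pair_imp_pdy:
  assumes "(f has_derivative (\<lambda>(h, k). \<alpha> * h + \<beta> * k)) (at (x, y))"
  shows "((\<lambda>t. f (x, t)) has_field_derivative \<beta>) (at y)"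
proof -
  have "((\<lambda>t. f (x, t)) has_derivative (\<lambda>k. (\<lambda>(h, k). \<alpha> * h + \<beta> * k) (0, k))) (at y)"
    by (rule has_derivative_compose[of "\<lambda>t. (x, t)" "\<lambda>k. (0, k)", OF _ assms])
       (auto intro!: derivative_eq_intros)
  then show ?thesis by (simp add: has_field_derivative_def)
qed

lemma holomorphic2_on_has_derivative:
  assumes "f holomorphic2_on U" "q \<in> U"
  shows "(f has_derivative (\<lambda>(h, k). pdx f q * h + pdy f q * k)) (at q)"
proof -
  obtain \<alpha> \<beta> where d: "(f has_derivative (\<lambda>(h, k). \<alpha> * h + \<beta> * k)) (at q)"
    using assms unfolding holomorphic2_on_def by blast
  obtain x y where q: "q = (x, y)" by (cases q)
  have "pdx f q = \<alpha>" "pdy f q = \<beta>"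
    using has_derivative_pair_imp_pdx[OF d[unfolded q]] has_derivative_pair_imp_pdy[OF d[unfolded q]]
    by (auto simp: q pdx_def pdy_def DERIV_imp_deriv)
  with d show ?thesis by simp
qed

lemma holomorphic2_on_has_pdx:
  assumes "f holomorphic2_on U" "(x, y) \<in> U"
  shows "((\<lambda>s. f (s, y)) has_field_derivative pdx f (x, y)) (at x)"
  using has_derivative_pair_imp_pdx[OF holomorphic2_on_has_derivative[OF assms]] .

lemma holomorphic2_on_has_pdy:
  assumes "f holomorphic2_on U" "(x, y) \<in> U"
  shows "((\<lambda>t. f (x, t)) has_field_derivative pdy f (x, y)) (at y)"
  using has_derivative_pair_imp_pdy[OF holomorphic2_on_has_derivative[OF assms]] .

lemma holomorphic2_on_imp_field_differentiable:
  assumes "f holomorphic2_on U" "(x, y) \<in> U"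
  shows "(\<lambda>s. f (s, y)) field_differentiable (at x)" "(\<lambda>t. f (x, t)) field_differentiable (at y)"
  using holomorphic2_on_has_pdx[OF assms] holomorphic2_on_has_pdy[OF assms]
  unfolding field_differentiable_def by blast+

lemma holomorphic2_on_imp_continuous_on: "f holomorphic2_on U \<Longrightarrow> continuous_on U f"
  by (meson continuous_at_imp_continuous_on has_derivative_continuous holomorphic2_on_has_derivative)

lemma holomorphic2_on_swap:
  assumes "f holomorphic2_on U" shows "(f \<circ> prod.swap) holomorphic2_on (prod.swap -` U)"
  unfolding holomorphic2_on_def
proof (intro conjI ballI)
  show "open (prod.swap -` U)" using assms open_vimage_swap holomorphic2_on_def by blast
next
  fix q assume "q \<in> prod.swap -` U"
  then have q: "prod.swap q \<in> U" by simp
  have "(prod.swap has_derivative prod.swap) (at q)"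
    using bounded_linear_imp_has_derivative[of prod.swap]
    by (simp add: prod.swap_def[abs_def] bounded_linear_Pair bounded_linear_snd bounded_linear_fst)
  from has_derivative_compose[OF this holomorphic2_on_has_derivative[OF assms q]]
  have "(f \<circ> prod.swap has_derivative
      (\<lambda>(h, k). pdy f (prod.swap q) * h + pdx f (prod.swap q) * k)) (at q)"
    by (simp add: o_def case_prod_unfold add.commute)
  then show "\<exists>\<alpha> \<beta>. (f \<circ> prod.swap has_derivative (\<lambda>(h, k). \<alpha> * h + \<beta> * k)) (at q)"
    by blast
qed

text \<open>
  A weak form of Osgood's lemma.  One partial derivative being continuous is enough to get the
  total derivative from the two partial ones.
\<close>

lemma holomorphic2_on_separatelyI:
  assumes U: "open U" and cont: "continuous_on U f"
    and dx: "\<And>x y. (x, y) \<in> U \<Longrightarrow> (\<lambda>s. f (s, y)) field_differentiable (at x)"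
    and dy: "\<And>x y. (x, y) \<in> U \<Longrightarrow> (\<lambda>t. f (x, t)) field_differentiable (at y)"
  shows "f holomorphic2_on U"
  unfolding holomorphic2_on_def
proof (intro conjI U ballI)
  fix q assume "q \<in> U"
  obtain x y where q: "q = (x, y)" by (cases q)
  with \<open>q \<in> U\<close> have xy: "(x, y) \<in> U" by simp
  obtain r where r: "r > 0" "cball x r \<times> cball y r \<subseteq> U"
    using open_contains_cball_Times[OF U xy] .
  define X Y where "X = ball x r" and "Y = ball y r"
  have XY: "X \<times> Y \<subseteq> U" "open X" "open Y" "x \<in> X" "y \<in> Y" using r by (auto simp: X_def Y_def)
  have "((\<lambda>(x, y). f (x, y)) has_derivative
      (\<lambda>(h, k). pdx f (x, y) * h + blinfun_mult_right (pdy f (x, y)) k)) (at (x, y) within X \<times> Y)"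
  proof (rule has_derivative_partialsI)
    show "((\<lambda>s. f (s, y)) has_derivative (*) (pdx f (x, y))) (at x within X)"
      using dx[OF xy] unfolding has_field_derivative_def[symmetric]
      by (simp add: pdx_def field_differentiable_derivI has_field_derivative_at_within)
    show "((\<lambda>t. f (s, t)) has_derivative blinfun_mult_right (pdy f (s, t))) (at t within Y)"
      if "s \<in> X" "t \<in> Y" for s t
      using dy[of s t] that XY unfolding blinfun_mult_right.rep_eq has_field_derivative_def[symmetric]
      by (auto simp: pdy_def field_differentiable_derivI has_field_derivative_at_within)
    have "isCont (\<lambda>(s, t). blinfun_mult_right (pdy f (s, t))) (x, y)"
      using bounded_linear.isCont[OF bounded_linear_blinfun_mult_right isCont_pdy[OF U xy cont dy]]
      by (simp add: case_prod_unfold)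
    then show "continuous (at (x, y) within X \<times> Y) (\<lambda>(s, t). blinfun_mult_right (pdy f (s, t)))"
      by (rule continuous_at_imp_continuous_at_within)
  qed (use XY in \<open>auto simp: Y_def\<close>)
  moreover have "at (x, y) within X \<times> Y = at (x, y)"
    using XY by (intro at_within_open open_Times) auto
  ultimately show "\<exists>\<alpha> \<beta>. (f has_derivative (\<lambda>(h, k). \<alpha> * h + \<beta> * k)) (at q)"
    by (auto simp: q blinfun_mult_right.rep_eq split_beta)
qed

text \<open>
  The difference quotients of \<open>f\<close> in the first variable converge to \<open>pdx f (x, \<cdot>)\<close>, uniformly
  near \<open>y\<close> since \<open>pdx f\<close> is continuous.  Hence so do their \<open>y\<close>-derivatives, which are the
  difference quotients of \<open>pdy f (\<cdot>, y)\<close>.  This yields at once the differentiability of \<open>pdy f\<close> in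
  the first variable and the symmetry of the mixed derivatives.
\<close>

lemma has_field_derivative_pdy_in_x:
  assumes f: "f holomorphic2_on U" and xy: "(x, y) \<in> U"
  shows "((\<lambda>s. pdy f (s, y)) has_field_derivative pdy (pdx f) (x, y)) (at x)"
proof -
  have U: "open U" using f by (simp add: holomorphic2_on_def)
  obtain r where r: "r > 0" "cball x r \<times> cball y r \<subseteq> U"
    using open_contains_cball_Times[OF U xy] .
  have inU: "(s, t) \<in> U" if "s \<in> cball x r" "t \<in> cball y r" for s t
    using that r by blast
  have cont: "continuous_on U (pdx f)"
  proof (intro continuous_at_imp_continuous_on ballI)
    fix q assume "q \<in> U"
    then show "isCont (pdx f) q"
      using isCont_pdx[OF U _ holomorphic2_on_imp_continuous_on[OF f]] holomorphic2_on_has_pdx[OF f]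
      unfolding field_differentiable_def by (cases q) blast
  qed
  define g where "g = (\<lambda>h t. (f (x + h, t) - f (x, t)) / h)"
  have small: "eventually (\<lambda>h::complex. norm h < d \<and> h \<noteq> 0) (at 0)" if "d > 0" for d
    using that by (auto simp: eventually_at)
  have "uniform_limit (ball y r) g (\<lambda>t. pdx f (x, t)) (at 0)"
  proof (rule uniform_limitI)
    fix e :: real assume "e > 0"
    have "uniformly_continuous_on (cball x r \<times> cball y r) (pdx f)"
      by (intro compact_uniformly_continuous continuous_on_subset[OF cont r(2)] compact_Times
            compact_cball)
    then obtain d where d: "d > 0" "\<And>p q. p \<in> cball x r \<times> cball y r \<Longrightarrow> q \<in> cball x r \<times> cball y r
        \<Longrightarrow> dist q p < d \<Longrightarrow> dist (pdx f q) (pdx f p) < e / 2"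
      using half_gt_zero[OF \<open>e > 0\<close>] unfolding uniformly_continuous_on_def by metis
    have "eventually (\<lambda>h::complex. norm h < min d r \<and> h \<noteq> 0) (at 0)"
      using d r by (intro small) auto
    then show "\<forall>\<^sub>F h in at 0. \<forall>t\<in>ball y r. dist (g h t) (pdx f (x, t)) < e"
    proof (eventually_elim, intro ballI)
      fix h t :: complex assume h: "norm h < min d r \<and> h \<noteq> 0" and t: "t \<in> ball y r"
      define m where "m = min d r"
      define F where "F = (\<lambda>s. f (s, t) - s * pdx f (x, t))"
      have "norm (F (x + h) - F x) \<le> e / 2 * norm (x + h - x)"
      proof (rule field_differentiable_bound)
        show "convex (ball x m)" by simp
        fix s assume s: "s \<in> ball x m"
        then have st: "(s, t) \<in> U" using t by (intro inU) (auto simp: m_def)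
        show "(F has_field_derivative pdx f (s, t) - pdx f (x, t)) (at s within ball x m)"
          unfolding F_def
          by (rule has_field_derivative_at_within)
             (auto intro!: derivative_eq_intros holomorphic2_on_has_pdx[OF f st])
        have "dist (pdx f (s, t)) (pdx f (x, t)) < e / 2"
          using s t r by (intro d(2)) (auto simp: m_def dist_Pair_Pair dist_commute)
        then show "norm (pdx f (s, t) - pdx f (x, t)) \<le> e / 2" by (simp add: dist_norm)
      qed (use h r d in \<open>auto simp: m_def dist_norm\<close>)
      then have "norm ((F (x + h) - F x) / h) \<le> e / 2"
        using h by (simp add: norm_divide field_simps)
      moreover have "(F (x + h) - F x) / h = g h t - pdx f (x, t)"
        using h by (simp add: F_def g_def field_simps)
      ultimately show "dist (g h t) (pdx f (x, t)) < e"
        using \<open>e > 0\<close> by (simp add: dist_norm)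
    qed
  qed
  moreover have g': "(g h has_field_derivative (pdy f (x + h, t) - pdy f (x, t)) / h) (at t)"
    if "norm h < r" "h \<noteq> 0" "t \<in> ball y r" for h t
    unfolding g_def using that r
    by (intro DERIV_cdivide DERIV_diff holomorphic2_on_has_pdy[OF f] inU) (auto simp: dist_norm)
  moreover have "\<forall>\<^sub>F h in at 0. g h holomorphic_on ball y r"
    using small[OF r(1)]
    by (rule eventually_mono) (unfold holomorphic_on_open[OF open_ball], blast intro: g')
  ultimately have "((\<lambda>h. deriv (g h) y) \<longlongrightarrow> deriv (\<lambda>t. pdx f (x, t)) y) (at 0)"
    using r(1) by (intro deriv_complex_uniform_limit[where A = "ball y r"]) auto
  moreover have "\<forall>\<^sub>F h in at 0. deriv (g h) y = (pdy f (x + h, y) - pdy f (x, y)) / h"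
    using small[OF r(1)] by (rule eventually_mono) (use g' r in \<open>auto intro!: DERIV_imp_deriv\<close>)
  ultimately have "((\<lambda>h. (pdy f (x + h, y) - pdy f (x, y)) / h) \<longlongrightarrow> pdy (pdx f) (x, y)) (at 0)"
    by (simp add: pdy_def[of "pdx f"] tendsto_cong)
  then show ?thesis by (simp add: DERIV_def)
qed

lemma holomorphic2_on_pdy:
  assumes f: "f holomorphic2_on U" shows "pdy f holomorphic2_on U"
proof (rule holomorphic2_on_separatelyI)
  show U: "open U" using f by (simp add: holomorphic2_on_def)
  show "continuous_on U (pdy f)"
  proof (intro continuous_at_imp_continuous_on ballI)
    fix q assume "q \<in> U"
    then show "isCont (pdy f) q"
      using isCont_pdy[OF U _ holomorphic2_on_imp_continuous_on[OF f]] holomorphic2_on_has_pdy[OF f]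
      unfolding field_differentiable_def by (cases q) blast
  qed
  fix x y assume xy: "(x, y) \<in> U"
  show "(\<lambda>s. pdy f (s, y)) field_differentiable (at x)"
    using has_field_derivative_pdy_in_x[OF f xy] by (auto simp: field_differentiable_def)
  obtain r where r: "r > 0" "cball x r \<times> cball y r \<subseteq> U"
    using open_contains_cball_Times[OF U xy] .
  have "(\<lambda>t. f (x, t)) holomorphic_on ball y r"
    using r holomorphic2_on_has_pdy[OF f, of x]
    by (force simp: holomorphic_on_open)
  then have "deriv (\<lambda>t. f (x, t)) holomorphic_on ball y r" by (rule holomorphic_deriv) simp
  then show "(\<lambda>t. pdy f (x, t)) field_differentiable (at y)"
    using r(1) by (auto simp: pdy_def holomorphic_on_def at_within_open[of _ "ball y r"])
qed

lemma holomorphic2_on_pdx: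
  assumes f: "f holomorphic2_on U" shows "pdx f holomorphic2_on U"
  using holomorphic2_on_swap[OF holomorphic2_on_pdy[OF holomorphic2_on_swap[OF f]]]
  by (simp add: pdy_swap o_assoc[symmetric] vimage_comp)

lemma pdx_pdy_commute:
  assumes f: "f holomorphic2_on U" "q \<in> U" shows "pdx (pdy f) q = pdy (pdx f) q"
  using has_field_derivative_pdy_in_x[OF f(1), of "fst q" "snd q"] f(2)
  by (auto simp: pdx_def[of "pdy f"] split_beta intro: DERIV_imp_deriv)

lemma holomorphic2_on_open: "f holomorphic2_on U \<Longrightarrow> open U"
  by (simp add: holomorphic2_on_def)

lemma holomorphic2_on_add:
  assumes "f holomorphic2_on U" "g holomorphic2_on U"
  shows "(\<lambda>q. f q + g q) holomorphic2_on U"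
  using assms
  by (auto intro!: holomorphic2_on_separatelyI continuous_intros derivative_intros
        dest: holomorphic2_on_open holomorphic2_on_imp_continuous_on
          holomorphic2_on_imp_field_differentiable)

lemma holomorphic2_on_mult:
  assumes "f holomorphic2_on U" "g holomorphic2_on U"
  shows "(\<lambda>q. f q * g q) holomorphic2_on U"
  using assms
  by (auto intro!: holomorphic2_on_separatelyI continuous_intros derivative_intros
        dest: holomorphic2_on_open holomorphic2_on_imp_continuous_on
          holomorphic2_on_imp_field_differentiable)

lemma holomorphic2_on_rational_coefficients:
  assumes "open U"
  shows "(\<lambda>q. k) holomorphic2_on U" "fst holomorphic2_on U" "snd holomorphic2_on U"
    "(\<And>q. q \<in> U \<Longrightarrow> fst q \<noteq> 0) \<Longrightarrow> (\<lambda>q. snd q / fst q - 1) holomorphic2_on U"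
  using assms
  by (force intro!: holomorphic2_on_separatelyI continuous_intros derivative_intros)+

lemma holomorphic2_on_subset:
  "f holomorphic2_on U \<Longrightarrow> open V \<Longrightarrow> V \<subseteq> U \<Longrightarrow> f holomorphic2_on V"
  by (auto simp: holomorphic2_on_def)

lemma Dx_eq: "Dx f = (\<lambda>q. fst q * pdx f q)" by (auto simp: Dx_def)
lemma Dy_eq: "Dy f = (\<lambda>q. snd q * pdy f q)" by (auto simp: Dy_def)

lemma pdx_pdy_cong_open:
  assumes "open V" "q \<in> V" "\<And>p. p \<in> V \<Longrightarrow> f p = g p"
  shows "pdx f q = pdx g q" "pdy f q = pdy g q"
proof -
  obtain x y where q: "q = (x, y)" by (cases q)
  have V: "eventually (\<lambda>p. p \<in> V) (nhds (x, y))"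
    using assms q by (simp add: eventually_nhds_in_open)
  have "filterlim (\<lambda>s. (s, y)) (nhds (x, y)) (nhds x)" "filterlim (\<lambda>t. (x, t)) (nhds (x, y)) (nhds y)"
    by (auto intro!: tendsto_intros filterlim_ident)
  then have "eventually (\<lambda>s. (s, y) \<in> V) (nhds x)" "eventually (\<lambda>t. (x, t) \<in> V) (nhds y)"
    using V by (auto simp: filterlim_iff)
  then show "pdx f q = pdx g q" "pdy f q = pdy g q"
    using assms(3) by (auto simp: q pdx_def pdy_def intro!: deriv_cong_ev elim: eventually_mono)
qed

lemma Dx_Dy_cong_open:
  assumes "open V" "q \<in> V" "\<And>p. p \<in> V \<Longrightarrow> f p = g p"
  shows "Dx f q = Dx g q" "Dy f q = Dy g q"
  using pdx_pdy_cong_open[OF assms] by (simp_all add: Dx_eq Dy_eq)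

section \<open>Euler operators after the change of variables\<close>

text \<open>
  In the application \<open>M\<close> is a branch of \<open>(1 - y) powr (- b')\<close>.  Only its differential equation
  \<open>M' = s / (1 - y) * M\<close> with \<open>s = b'\<close> matters for the operators.
\<close>

definition pullback :: "(complex \<Rightarrow> complex) \<Rightarrow> (complex \<times> complex \<Rightarrow> complex) \<Rightarrow>
    complex \<times> complex \<Rightarrow> complex" where
  "pullback M g = (\<lambda>(x, y). M y * g (x, x / (1 - y)))"

text \<open>
  The Euler operators acting on \<open>pullback M g\<close>, transported to \<open>g\<close>.  The coefficient
  \<open>snd q / fst q - 1\<close> is \<open>y / (1 - y)\<close> in the old coordinates; expressing it in the new ones makes
  the class of pullbacks stable under both operators, so that they can be iterated.
\<close>

definition lifted_Dx :: "(complex \<times> complex \<Rightarrow> complex) \<Rightarrow> complex \<times> complex \<Rightarrow> complex" where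
  "lifted_Dx g = (\<lambda>q. Dx g q + Dy g q)"

definition lifted_Dy :: "complex \<Rightarrow> (complex \<times> complex \<Rightarrow> complex) \<Rightarrow>
    complex \<times> complex \<Rightarrow> complex" where
  "lifted_Dy s g = (\<lambda>q. (snd q / fst q - 1) * (s * g q + Dy g q))"

lemma lifted_Dx_pair: "lifted_Dx g (x, t) = x * pdx g (x, t) + t * pdy g (x, t)"
  by (simp add: lifted_Dx_def Dx_def Dy_def)

lemma lifted_Dy_pair: "lifted_Dy s g (x, t) = (t / x - 1) * (s * g (x, t) + t * pdy g (x, t))"
  by (simp add: lifted_Dy_def Dy_def)

lemma has_derivative_pullback:
  assumes g: "g holomorphic2_on U" "(x, x / (1 - y)) \<in> U" and y: "y \<noteq> 1"
    and M: "(M has_field_derivative s / (1 - y) * M y) (at y)"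
  defines "p \<equiv> (x, x / (1 - y))"
  shows "(pullback M g has_derivative (\<lambda>(h, k).
      (M y * (pdx g p + pdy g p / (1 - y))) * h +
      (M y * (s / (1 - y) * g p + pdy g p * x / (1 - y) ^ 2)) * k)) (at (x, y))"
proof -
  have 1: "((\<lambda>q. (fst q, fst q / (1 - snd q))) has_derivative
      (\<lambda>(h, k). (h, h / (1 - y) + k * x / (1 - y) ^ 2))) (at (x, y))"
    using y by (auto intro!: derivative_eq_intros simp: case_prod_unfold fun_eq_iff divide_simps
        power2_eq_square) (simp_all add: algebra_simps)?
  have 2: "((\<lambda>q. g (fst q, fst q / (1 - snd q))) has_derivative
      (\<lambda>hk. (\<lambda>(h, k). pdx g p * h + pdy g p * k)
        ((\<lambda>(h, k). (h, h / (1 - y) + k * x / (1 - y) ^ 2)) hk))) (at (x, y))"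
    by (rule has_derivative_compose[OF 1])
       (use holomorphic2_on_has_derivative[OF g] in \<open>simp add: p_def\<close>)
  have 3: "((\<lambda>q. M (snd q)) has_derivative (\<lambda>hk. s / (1 - y) * M y * snd hk)) (at (x, y))"
    using has_derivative_compose[OF has_derivative_snd[OF has_derivative_ident],
        of M "(*) (s / (1 - y) * M y)" "(x, y)" UNIV] M
    by (simp add: has_field_derivative_def)
  show ?thesis
    unfolding pullback_def case_prod_unfold
    by (rule has_derivative_eq_rhs[OF has_derivative_mult[OF 3 2]])
       (auto simp: p_def fun_eq_iff algebra_simps)
qed

context
  fixes U V M s
  assumes U: "open U" "\<And>q. q \<in> U \<Longrightarrow> fst q \<noteq> (0::complex)"
    and V: "open V" "\<And>x y. (x, y) \<in> V \<Longrightarrow> y \<noteq> 1 \<and> (x, x / (1 - y)) \<in> U"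
    and M: "\<And>x y. (x, y) \<in> V \<Longrightarrow> (M has_field_derivative s / (1 - y) * M y) (at y)"
begin

lemma holomorphic2_on_pullback:
  assumes "g holomorphic2_on U" shows "pullback M g holomorphic2_on V"
  unfolding holomorphic2_on_def
proof (intro conjI V ballI)
  fix q assume "q \<in> V"
  then show "\<exists>\<alpha> \<beta>. (pullback M g has_derivative (\<lambda>(h, k). \<alpha> * h + \<beta> * k)) (at q)"
    using has_derivative_pullback[OF assms, of "fst q" "snd q" M s] V(2)[of "fst q" "snd q"]
      M[of "fst q" "snd q"] by auto
qed

lemma D_pullback:
  assumes g: "g holomorphic2_on U" and q: "q \<in> V"
  shows "Dx (pullback M g) q = pullback M (lifted_Dx g) q"
    "Dy (pullback M g) q = pullback M (lifted_Dy s g) q"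
proof -
  obtain x y where xy: "q = (x, y)" by (cases q)
  have y: "y \<noteq> 1" "1 - y \<noteq> 0" "(x, x / (1 - y)) \<in> U" using V(2) q xy by auto
  have x: "x \<noteq> 0" using U(2)[OF y(3)] by simp
  note d = has_derivative_pullback[OF g y(3) y(1) M[OF q[unfolded xy]]]
  show "Dx (pullback M g) q = pullback M (lifted_Dx g) q"
    using DERIV_imp_deriv[OF has_derivative_pair_imp_pdx[OF d]]
    by (simp add: Dx_def Dy_def xy lifted_Dx_def pullback_def
        pdx_def[of "\<lambda>(x, y). _ x y"] algebra_simps)
  have r: "x / (1 - y) / x - 1 = y / (1 - y)" using x y(2) by (simp add: field_simps)
  have "Dy (pullback M g) q
      = y * (M y * (s / (1 - y) * g (x, x / (1 - y)) + pdy g (x, x / (1 - y)) * x / (1 - y) ^ 2))"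
    using DERIV_imp_deriv[OF has_derivative_pair_imp_pdy[OF d]] by (simp add: Dy_def pdy_def xy)
  also have "\<dots> = pullback M (lifted_Dy s g) q"
    unfolding xy pullback_def lifted_Dy_def Dy_def split fst_conv snd_conv r
    by (simp add: algebra_simps power2_eq_square)
  finally show "Dy (pullback M g) q = pullback M (lifted_Dy s g) q" .
qed

lemma D_locally_pullback:
  assumes g: "g holomorphic2_on U" and q: "q \<in> V" and f: "\<And>p. p \<in> V \<Longrightarrow> f p = pullback M g p"
  shows "Dx f q = pullback M (lifted_Dx g) q" "Dy f q = pullback M (lifted_Dy s g) q"
  using Dx_Dy_cong_open[OF V(1) q f] D_pullback[OF g q] by auto

lemma holomorphic2_on_lifted_D:
  assumes g: "g holomorphic2_on U"
  shows "lifted_Dx g holomorphic2_on U" "lifted_Dy s g holomorphic2_on U"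
  unfolding lifted_Dx_def lifted_Dy_def Dx_eq Dy_eq
  by (intro holomorphic2_on_add holomorphic2_on_mult holomorphic2_on_rational_coefficients U
        holomorphic2_on_pdx holomorphic2_on_pdy g; assumption)+

text \<open>
  The second-order operators of \<open>E\<^sub>2\<close> are iterated Euler operators with coefficients in the
  coordinates, so each inner application produces a pullback to which the outer one applies.
\<close>

lemma P2_pullback:
  fixes a b c :: complex
  assumes v: "v holomorphic2_on U" and q: "(x, y) \<in> V"
  defines "w \<equiv> \<lambda>q. b * v q + lifted_Dx v q"
  shows "P2 a b c (pullback M v) (x, y) = pullback M (\<lambda>q.
     lifted_Dx (\<lambda>q. (c - 1) * v q + lifted_Dx v q) q
      - fst q * (a * w q + lifted_Dx w q + lifted_Dy s w q)) (x, y)"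
proof -
  have lin: "(\<lambda>q. k * v q + lifted_Dx v q) holomorphic2_on U" for k
    by (intro holomorphic2_on_add holomorphic2_on_mult v holomorphic2_on_lifted_D
          holomorphic2_on_rational_coefficients U)
  have *: "k * pullback M v p + Dx (pullback M v) p = pullback M (\<lambda>q. k * v q + lifted_Dx v q) p"
    if "p \<in> V" for k p
    using D_pullback(1)[OF v that] by (simp add: pullback_def case_prod_unfold algebra_simps)
  have D: "Dx (\<lambda>q. k * pullback M v q + Dx (pullback M v) q) (x, y)
        = pullback M (lifted_Dx (\<lambda>q. k * v q + lifted_Dx v q)) (x, y)"
      "Dy (\<lambda>q. k * pullback M v q + Dx (pullback M v) q) (x, y)
        = pullback M (lifted_Dy s (\<lambda>q. k * v q + lifted_Dx v q)) (x, y)" for k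
    by (rule D_locally_pullback[OF lin q *]; assumption)+
  show ?thesis
    unfolding P2_def Let_def split D * [OF q] w_def
    by (simp add: pullback_def algebra_simps)
qed

lemma Q2_pullback:
  fixes a b' c' :: complex
  assumes v: "v holomorphic2_on U" and q: "(x, y) \<in> V"
  defines "w \<equiv> \<lambda>q. b' * v q + lifted_Dy s v q"
  shows "Q2 a b' c' (pullback M v) (x, y) = pullback M (\<lambda>q.
     lifted_Dy s (\<lambda>q. (c' - 1) * v q + lifted_Dy s v q) q
      - (1 - fst q / snd q) * (a * w q + lifted_Dx w q + lifted_Dy s w q)) (x, y)"
proof -
  have lin: "(\<lambda>q. k * v q + lifted_Dy s v q) holomorphic2_on U" for k
    by (intro holomorphic2_on_add holomorphic2_on_mult v holomorphic2_on_lifted_D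
          holomorphic2_on_rational_coefficients U)
  have *: "k * pullback M v p + Dy (pullback M v) p = pullback M (\<lambda>q. k * v q + lifted_Dy s v q) p"
    if "p \<in> V" for k p
    using D_pullback(2)[OF v that] by (simp add: pullback_def case_prod_unfold algebra_simps)
  have D: "Dx (\<lambda>q. k * pullback M v q + Dy (pullback M v) q) (x, y)
        = pullback M (lifted_Dx (\<lambda>q. k * v q + lifted_Dy s v q)) (x, y)"
      "Dy (\<lambda>q. k * pullback M v q + Dy (pullback M v) q) (x, y)
        = pullback M (lifted_Dy s (\<lambda>q. k * v q + lifted_Dy s v q)) (x, y)" for k
    by (rule D_locally_pullback[OF lin q *]; assumption)+
  \<comment> \<open>The coefficient \<open>y\<close> of the second equation, in the new coordinates.\<close>
  have y: "1 - x / (x / (1 - y)) = y"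
    using V(2)[OF q] U(2)[of "(x, x / (1 - y))"] by (simp add: field_simps)
  show ?thesis
    unfolding Q2_def Let_def split D * [OF q] w_def
    unfolding pullback_def split fst_conv snd_conv y
    by (simp add: algebra_simps)
qed

end

section \<open>Reduction of the second system to the first\<close>

text \<open>
  With \<open>\<theta> = x \<partial>/\<partial>x\<close>, \<open>\<phi> = t \<partial>/\<partial>t\<close> the transported operator is
  \<open>(\<theta> + \<phi>) (c - 1 + \<theta> + \<phi>) - x (a + \<theta> + \<phi> + (t / x - 1) (s + \<phi>)) (b + \<theta> + \<phi>)\<close>.  Its middle factor
  multiplied by \<open>x\<close> is \<open>x (a - s + \<theta>) + t (s + \<phi>)\<close>, and the leading term splits as \<open>\<theta> + \<phi>\<close>: the
  operator is the sum of the Euler forms \<open>x P\<^sub>1\<close> and \<open>t Q\<^sub>1\<close> of the equations with parameters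
  \<open>b, a - s, s, c\<close>.
\<close>

lemma lifted_P2_eq:
  fixes a b c s :: complex
  assumes v: "v holomorphic2_on U" and q: "(x, t) \<in> U" and x: "x \<noteq> 0"
  defines "w \<equiv> \<lambda>q. b * v q + lifted_Dx v q"
  shows "lifted_Dx (\<lambda>q. (c - 1) * v q + lifted_Dx v q) (x, t)
      - x * (a * w (x, t) + lifted_Dx w (x, t) + lifted_Dy s w (x, t))
    = x * P1 b (a - s) s c v (x, t) + t * Q1 b (a - s) s c v (x, t)"
proof -
  define vx vt vxx vxt vtt where "vx = pdx v (x, t)" and "vt = pdy v (x, t)"
    and "vxx = pdx (pdx v) (x, t)" and "vxt = pdx (pdy v) (x, t)" and "vtt = pdy (pdy v) (x, t)"
  note has = holomorphic2_on_has_pdx[OF v q] holomorphic2_on_has_pdy[OF v q]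
    holomorphic2_on_has_pdx[OF holomorphic2_on_pdx[OF v] q]
    holomorphic2_on_has_pdy[OF holomorphic2_on_pdx[OF v] q]
    holomorphic2_on_has_pdx[OF holomorphic2_on_pdy[OF v] q]
    holomorphic2_on_has_pdy[OF holomorphic2_on_pdy[OF v] q]
  note has = has[folded pdx_pdy_commute[OF v q],
      folded vx_def vt_def vxx_def vxt_def vtt_def]
  have px: "pdx (\<lambda>q. k * v q + lifted_Dx v q) (x, t) = k * vx + (vx + x * vxx + t * vxt)" for k
    unfolding pdx_def[of "\<lambda>q. _ q + _ q"] lifted_Dx_def Dx_eq Dy_eq
    by (auto intro!: DERIV_imp_deriv derivative_eq_intros has simp: vx_def)
  have pt: "pdy (\<lambda>q. k * v q + lifted_Dx v q) (x, t) = k * vt + (x * vxt + vt + t * vtt)" for k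
    unfolding pdy_def[of "\<lambda>q. _ q + _ q"] lifted_Dx_def Dx_eq Dy_eq
    by (auto intro!: DERIV_imp_deriv derivative_eq_intros has simp: vt_def)
  show ?thesis
    unfolding w_def P1_def Q1_def split lifted_Dx_pair lifted_Dy_pair px pt
      vx_def[symmetric] vt_def[symmetric] vxx_def[symmetric] vxt_def[symmetric] vtt_def[symmetric]
    using x by (simp add: field_simps)
qed

text \<open>
  All second-order terms except the mixed one cancel, as do the terms of order zero.  In \<open>Q2\<close> a
  last parameter \<open>c'\<close> other than \<open>a\<close> would leave the extra term \<open>(c' - a) (t / x - 1) (s + \<phi>) v\<close>
  with \<open>\<phi> = t \<partial>/\<partial>t\<close>; hence the inner constant \<open>a - 1\<close>.
\<close>

lemma lifted_Q2_eq:
  fixes a s :: complex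
  assumes v: "v holomorphic2_on U" and q: "(x, t) \<in> U" and nz: "x \<noteq> 0" "t \<noteq> 0"
  defines "w \<equiv> \<lambda>q. s * v q + lifted_Dy s v q"
  shows "lifted_Dy s (\<lambda>q. (a - 1) * v q + lifted_Dy s v q) (x, t)
      - (1 - x / t) * (a * w (x, t) + lifted_Dx w (x, t) + lifted_Dy s w (x, t))
    = (t - x) * R1 (a - s) s v (x, t)"
proof -
  define vx vt vxt vtt where "vx = pdx v (x, t)" and "vt = pdy v (x, t)"
    and "vxt = pdx (pdy v) (x, t)" and "vtt = pdy (pdy v) (x, t)"
  note has = holomorphic2_on_has_pdx[OF v q] holomorphic2_on_has_pdy[OF v q]
    holomorphic2_on_has_pdx[OF holomorphic2_on_pdy[OF v] q]
    holomorphic2_on_has_pdy[OF holomorphic2_on_pdy[OF v] q]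
  note has = has[folded vx_def vt_def vxt_def vtt_def]
  have px: "pdx (\<lambda>q. k * v q + lifted_Dy s v q) (x, t)
      = k * vx - t / x ^ 2 * (s * v (x, t) + t * vt) + (t / x - 1) * (s * vx + t * vxt)" for k
    unfolding pdx_def[of "\<lambda>q. _ q + _ q"] lifted_Dy_def Dx_eq Dy_eq split fst_conv snd_conv
    by (rule DERIV_imp_deriv, (rule derivative_eq_intros has refl nz)+)
       (use nz in \<open>simp add: vx_def vt_def field_simps power2_eq_square\<close>)
  have pt: "pdy (\<lambda>q. k * v q + lifted_Dy s v q) (x, t)
      = k * vt + 1 / x * (s * v (x, t) + t * vt) + (t / x - 1) * (s * vt + (vt + t * vtt))" for k
    unfolding pdy_def[of "\<lambda>q. _ q + _ q"] lifted_Dy_def Dx_eq Dy_eq split fst_conv snd_conv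
    by (rule DERIV_imp_deriv, (rule derivative_eq_intros has refl nz)+)
       (use nz in \<open>simp add: vx_def vt_def field_simps power2_eq_square\<close>)
  show ?thesis
    unfolding w_def R1_def split lifted_Dx_pair lifted_Dy_pair px pt
      vx_def[symmetric] vt_def[symmetric] vxt_def[symmetric]
    using nz by (simp add: field_simps power2_eq_square)
qed

section \<open>Inclusion of the solution spaces\<close>

lemma germ_cong: "eventually (\<lambda>q. f q = g q) (nhds p) \<Longrightarrow> germ p f = germ p g"
  unfolding germ_def by (auto elim: eventually_elim2)

text \<open>
  If \<open>l\<close> is a branch of \<open>log (1 - \<cdot>)\<close>, then \<open>- l (- y / (1 - y))\<close> is one of \<open>log (1 - y)\<close>, so
  \<open>exp (s * l (- y / (1 - y)))\<close> is a branch of \<open>(1 - y) powr (- s)\<close>.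
\<close>

lemma has_field_derivative_exp_log_branch:
  assumes N: "open N" "l holomorphic_on N" "\<And>y. y \<in> N \<Longrightarrow> exp (l y) = 1 - y"
    and y: "- y / (1 - y) \<in> N" "y \<noteq> 1"
  shows "((\<lambda>y. exp (s * l (- y / (1 - y)))) has_field_derivative
      s / (1 - y) * exp (s * l (- y / (1 - y)))) (at y)"
proof -
  define t where "t = - y / (1 - y)"
  have t: "t \<in> N" "1 - t = 1 / (1 - y)" using y by (auto simp: t_def field_simps)
  obtain d where d: "(l has_field_derivative d) (at t)"
    using N t holomorphic_on_open by blast
  have "((\<lambda>y. exp (l y)) has_field_derivative exp (l t) * d) (at t)"
    using d by (auto intro!: derivative_eq_intros)
  moreover have "((\<lambda>y. exp (l y)) has_field_derivative - 1) (at t)"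
  proof (rule has_field_derivative_transform_within_open[OF _ N(1) t(1)])
    show "((\<lambda>y. 1 - y) has_field_derivative - 1) (at t)"
      by (auto intro!: derivative_eq_intros)
  qed (use N(3) in auto)
  ultimately have "exp (l t) * d = - 1" by (rule DERIV_unique)
  then have d': "d = - (1 - y)" using N(3)[OF t(1)] t(2) y(2) by (simp add: field_simps)
  have "((\<lambda>y. - y / (1 - y)) has_field_derivative - 1 / (1 - y) ^ 2) (at y)"
    using y(2) by (auto intro!: derivative_eq_intros simp: power2_eq_square)
  from DERIV_chain2[OF d[unfolded t_def] this]
  have "((\<lambda>y. l (- y / (1 - y))) has_field_derivative 1 / (1 - y)) (at y)"
  proof (rule DERIV_cong)
    have "- k * (- 1 / k ^ 2) = 1 / k" if "k \<noteq> 0" for k :: complex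
      using that by (simp add: power2_eq_square)
    from this[of "1 - y"] show "d * (- 1 / (1 - y) ^ 2) = 1 / (1 - y)"
      using y(2) by (simp add: d')
  qed
  from DERIV_fun_exp[OF DERIV_cmult[OF this]] show ?thesis
    by (rule DERIV_cong) simp
qed

theorem proposition1p3:
  fixes a b b' c x\<^sub>0 y\<^sub>0 :: complex and pw :: "complex \<Rightarrow> complex"
  assumes "x\<^sub>0 \<noteq> 0" "x\<^sub>0 \<noteq> 1" "y\<^sub>0 \<noteq> 0" "y\<^sub>0 \<noteq> 1" "x\<^sub>0 * (1 - y\<^sub>0) \<noteq> 1"
    and "power_branch (\<lambda>y. 1 - y) (- b') y\<^sub>0 pw"
  shows "(\<lambda>u. germ (x\<^sub>0, y\<^sub>0) (\<lambda>(x, y). pw y * u (x, - y / (1 - y))))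
           ` S2 a b b' c a (x\<^sub>0, - y\<^sub>0 / (1 - y\<^sub>0))
       \<supseteq> (\<lambda>v. germ (x\<^sub>0, y\<^sub>0) (\<lambda>(x, y). v (x, x * (1 - y))))
           ` S1 b (a - b') b' c (x\<^sub>0, x\<^sub>0 * (1 - y\<^sub>0))"
proof (rule image_subsetI)
  fix v assume "v \<in> S1 b (a - b') b' c (x\<^sub>0, x\<^sub>0 * (1 - y\<^sub>0))"
  then obtain U\<^sub>0 where U\<^sub>0: "(x\<^sub>0, x\<^sub>0 * (1 - y\<^sub>0)) \<in> U\<^sub>0" "v holomorphic2_on U\<^sub>0"
    and eqs: "\<And>q. q \<in> U\<^sub>0 \<Longrightarrow> P1 b (a - b') b' c v q = 0 \<and> Q1 b (a - b') b' c v q = 0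
        \<and> R1 (a - b') b' v q = 0"
    unfolding S1_def by blast
  obtain N l where N: "open N" "y\<^sub>0 \<in> N" "l holomorphic_on N"
    and l: "\<And>y. y \<in> N \<Longrightarrow> exp (l y) = 1 - y" and pw: "\<And>y. y \<in> N \<Longrightarrow> pw y = exp (- b' * l y)"
    using assms(6) unfolding power_branch_def by blast
  \<comment> \<open>The transported operator \<open>D'\<close> has a pole along \<open>fst q = 0\<close>.\<close>
  define U where "U = U\<^sub>0 \<inter> {q. fst q \<noteq> 0}"
  \<comment> \<open>Composed with the involution, \<open>M\<close> becomes \<open>exp (b' * l y)\<close>, the inverse of \<open>pw y\<close>.\<close>
  define M where "M = (\<lambda>y. exp (b' * l (- y / (1 - y))))"
  define V where "V = {q. snd q \<noteq> 1} \<inter>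
    (\<lambda>q. ((fst q, fst q / (1 - snd q)), - snd q / (1 - snd q))) -` (U \<times> N)"
  have "open U" unfolding U_def using holomorphic2_on_open[OF U\<^sub>0(2)]
    by (intro open_Int open_Collect_neq continuous_intros)
  have U: "open U" "\<And>q. q \<in> U \<Longrightarrow> fst q \<noteq> 0" using \<open>open U\<close> by (auto simp: U_def)
  have v: "v holomorphic2_on U" using holomorphic2_on_subset[OF U\<^sub>0(2) U(1)] by (simp add: U_def)
  have openV: "open V" unfolding V_def
    by (rule continuous_open_preimage)
       (auto intro!: continuous_intros open_Collect_neq open_Times U N(1))
  have V: "y \<noteq> 1 \<and> (x, x / (1 - y)) \<in> U" if "(x, y) \<in> V" for x y
    using that by (auto simp: V_def)
  have M: "(M has_field_derivative b' / (1 - y) * M y) (at y)" if "(x, y) \<in> V" for x y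
    unfolding M_def by (rule has_field_derivative_exp_log_branch[OF N(1,3) l])
      (use that in \<open>auto simp: V_def\<close>)
  have involution: "- y / (1 - y) \<noteq> 1" "x / (1 - - y / (1 - y)) = x * (1 - y)"
    "- (- y / (1 - y)) / (1 - - y / (1 - y)) = y" if "y \<noteq> 1" for x y :: complex
    using that by (auto simp: divide_simps)
  have "pullback M v \<in> S2 a b b' c a (x\<^sub>0, - y\<^sub>0 / (1 - y\<^sub>0))"
    unfolding S2_def
  proof (intro CollectI exI[of _ V] conjI ballI)
    show "(x\<^sub>0, - y\<^sub>0 / (1 - y\<^sub>0)) \<in> V"
      unfolding V_def using involution[OF assms(4)] U\<^sub>0(1) N(2) assms(1) by (simp add: U_def)
    show "pullback M v holomorphic2_on V"
      by (rule holomorphic2_on_pullback[OF U openV V M v])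
    fix q assume q: "q \<in> V"
    obtain x y where xy: "q = (x, y)" by (cases q)
    define t where "t = x / (1 - y)"
    have t: "(x, t) \<in> U" "x \<noteq> 0" "t \<noteq> 0"
      using V[OF q[unfolded xy]] U(2)[of "(x, t)"] by (simp_all add: t_def)
    have 0: "P1 b (a - b') b' c v (x, t) = 0" "Q1 b (a - b') b' c v (x, t) = 0"
      "R1 (a - b') b' v (x, t) = 0"
      using eqs t(1) by (auto simp: U_def)
    show "P2 a b c (pullback M v) q = 0" unfolding xy
    proof (subst P2_pullback[OF U openV V M v q[unfolded xy]])
      show "pullback M (\<lambda>q. lifted_Dx (\<lambda>q. (c - 1) * v q + lifted_Dx v q) q - fst q *
          (a * (b * v q + lifted_Dx v q) + lifted_Dx (\<lambda>q. b * v q + lifted_Dx v q) q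
            + lifted_Dy b' (\<lambda>q. b * v q + lifted_Dx v q) q)) (x, y) = 0"
        unfolding pullback_def split fst_conv t_def[symmetric] lifted_P2_eq[OF v t(1,2)]
        by (simp add: 0)
    qed
    show "Q2 a b' a (pullback M v) q = 0" unfolding xy
    proof (subst Q2_pullback[OF U openV V M v q[unfolded xy]])
      show "pullback M (\<lambda>q. lifted_Dy b' (\<lambda>q. (a - 1) * v q + lifted_Dy b' v q) q - (1 - fst q / snd q) *
          (a * (b' * v q + lifted_Dy b' v q) + lifted_Dx (\<lambda>q. b' * v q + lifted_Dy b' v q) q
            + lifted_Dy b' (\<lambda>q. b' * v q + lifted_Dy b' v q) q)) (x, y) = 0"
        unfolding pullback_def split fst_conv snd_conv t_def[symmetric] lifted_Q2_eq[OF v t]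
        by (simp add: 0)
    qed
  qed
  moreover have "germ (x\<^sub>0, y\<^sub>0) (\<lambda>(x, y). v (x, x * (1 - y)))
      = germ (x\<^sub>0, y\<^sub>0) (\<lambda>(x, y). pw y * pullback M v (x, - y / (1 - y)))"
  proof (rule germ_cong)
    have "\<forall>\<^sub>F q in nhds (x\<^sub>0, y\<^sub>0). q \<in> UNIV \<times> N"
      using N by (intro eventually_nhds_in_open open_Times) auto
    then show "\<forall>\<^sub>F q in nhds (x\<^sub>0, y\<^sub>0). (case q of (x, y) \<Rightarrow> v (x, x * (1 - y)))
        = (case q of (x, y) \<Rightarrow> pw y * pullback M v (x, - y / (1 - y)))"
    proof eventually_elim
      case (elim q)
      then obtain x y where xy: "q = (x, y)" "y \<in> N" by auto
      have "y \<noteq> 1" using l[OF xy(2)] by (metis diff_self exp_not_eq_zero)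
      from involution[OF this] have "pullback M v (x, - y / (1 - y)) = exp (b' * l y) * v (x, x * (1 - y))"
        by (simp add: pullback_def M_def)
      then show ?case by (simp add: xy pw[OF xy(2)] exp_minus)
    qed
  qed
  ultimately show "germ (x\<^sub>0, y\<^sub>0) (\<lambda>(x, y). v (x, x * (1 - y)))
      \<in> (\<lambda>u. germ (x\<^sub>0, y\<^sub>0) (\<lambda>(x, y). pw y * u (x, - y / (1 - y))))
           ` S2 a b b' c a (x\<^sub>0, - y\<^sub>0 / (1 - y\<^sub>0))"
    by (intro image_eqI[of _ _ "pullback M v"])
qed

end
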